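(* Let $F$ be a polynomial with integer coefficients. If $F$ is recursively-factorable then, for each $n \in \mathbb{Z}$ and each positive integer $p$ such that $p \mid F(n)$, there exists a finite sequence of integers $(x_1,x_2,\dots,x_m)$ such that $$n = \sum_{k=1}^m x_k\, f_{k-1}(x_1,\dots,x_{k-1}) \qquad\text{and}\qquad p = |f_m(x_1,\dots,x_{m-1},x_m)|.$$
   Context: Recursively-factorable: Let $F$ be a polynomial with integer coefficients. An integer factorization presentation $F(n) = p\,q$ (with $p,q\in\mathbb{Z}$) is trivial if $|p|=1$ or $|q|=1$, and non-trivial otherwise. An integer $n$ satisfies the recursively-factorable criterion for $F$ if for each non-trivial integer factorization presentation $F(n)=p\,q$ there exists $r \in \mathbb{Z}$ such that $|F(r)|<|F(n)|$ and ($r \equiv n \pmod{|p|}$ or $r \equiv n \pmod{|q|}$). $F$ is recursively-factorable if each $n\in\mathbb{Z}$ satisfies the recursively-factorable criterion for $F$. The polynomials $f_m$: for $F \in \mathbb{Z}[x]$ of degree $d$, the polynomials $f_m = f_m(x_1,\dots,x_m) \in \mathbb{Z}[x_1,\dots,x_m]$ are defined by $f_0=1$, $f_1(x_1)=F(x_1)$ and, for $m\ge 2$, $$f_m = f_{m-2} + x_m \sum_{j=1}^d \left(\tfrac{1}{j!}F^{(j)}\right)\!\left(\sum_{k=1}^{m-1} x_k f_{k-1}\right) (x_m f_{m-1})^{j-1},$$ where $F^{(j)}$ is the $j$th derivative of $F$ (so $\tfrac{1}{j!}F^{(j)}$ has integer coefficients). They satisfy $F\left(\sum_{k=1}^m x_k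 f_{k-1}\right) = f_{m-1} f_m$ for all $m\ge1$. *)

theory Defs
  imports "HOL-Computational_Algebra.Polynomial" "HOL-Number_Theory.Cong"
begin

definition trivial_factorization :: "int \<Rightarrow> int \<Rightarrow> bool" where
  "trivial_factorization p q \<longleftrightarrow> \<bar>p\<bar> = 1 \<or> \<bar>q\<bar> = 1"

definition rec_factorable_at :: "int poly \<Rightarrow> int \<Rightarrow> bool" where
  "rec_factorable_at F n \<longleftrightarrow>
     (\<forall>p q. poly F n = p * q \<and> \<not> trivial_factorization p q \<longrightarrow>
        (\<exists>r. \<bar>poly F r\<bar> < \<bar>poly F n\<bar> \<and> ([r = n] (mod \<bar>p\<bar>) \<or> [r = n] (mod \<bar>q\<bar>))))"

definition recursively_factorable :: "int poly \<Rightarrow> bool" where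
  "recursively_factorable F \<longleftrightarrow> (\<forall>n. rec_factorable_at F n)"

(* The polynomial (1/j!) F^(j). The coefficientwise division is exact, as shown by
   divided_deriv_exact below. *)
definition divided_deriv :: "nat \<Rightarrow> int poly \<Rightarrow> int poly" where
  "divided_deriv j F = map_poly (\<lambda>c. c div fact j) ((pderiv ^^ j) F)"

lemma divided_deriv_exact: "smult (fact j) (divided_deriv j F) = (pderiv ^^ j) F"
proof (rule poly_eqI)
  fix n
  have "(fact j :: int) dvd pochhammer (int (Suc n)) j"
  proof -
    have "pochhammer (int (Suc n)) j = int (pochhammer (Suc n) j)"
      by (simp only: pochhammer_of_nat)
    moreover have "fact j dvd pochhammer (Suc n) j"
    proof -
      have "fact n * pochhammer (Suc n) j = (fact (n + j) :: nat)"
        using pochhammer_product[of n "n + j" "1::nat"] by (simp add: pochhammer_fact)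
      also have "\<dots> = fact n * (fact j * ((n + j) choose n))"
        using binomial_fact_lemma[of n "n + j"] by (simp add: mult.assoc)
      finally show ?thesis by simp
    qed
    ultimately show ?thesis
      by (metis of_nat_dvd_iff of_nat_fact)
  qed
  then have "(fact j :: int) dvd coeff ((pderiv ^^ j) F) n"
    by (simp add: coeff_higher_pderiv)
  then show "coeff (smult (fact j) (divided_deriv j F)) n = coeff ((pderiv ^^ j) F) n"
    by (simp add: divided_deriv_def coeff_map_poly)
qed

(* The value f_m(x 1, ..., x m) at an integer point. Only x 1, ..., x m matter
   (f_poly_cong), so that x encodes a finite sequence; indices start at 1. *)
fun f_poly :: "int poly \<Rightarrow> nat \<Rightarrow> (nat \<Rightarrow> int) \<Rightarrow> int" where
  "f_poly F 0 x = 1"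
| "f_poly F (Suc 0) x = poly F (x 1)"
| "f_poly F (Suc (Suc m)) x =
     f_poly F m x + x (m + 2) *
       (\<Sum>j = 1..degree F.
          poly (divided_deriv j F) (\<Sum>k = 1..m + 1. x k * f_poly F (k - 1) x)
            * (x (m + 2) * f_poly F (m + 1) x) ^ (j - 1))"

lemma f_poly_cong:
  "(\<And>k. 1 \<le> k \<Longrightarrow> k \<le> m \<Longrightarrow> x k = y k) \<Longrightarrow> f_poly F m x = f_poly F m y"
proof (induction m rule: less_induct)
  case (less m)
  consider "m = 0" | "m = Suc 0" | l where "m = Suc (Suc l)"
    by (metis not0_implies_Suc)
  then show ?case
  proof cases
    case 3
    have IH: "f_poly F i x = f_poly F i y" if "i < m" for i
      using less that by simp
    have s: "(\<Sum>k = 1..l + 1. x k * f_poly F (k - 1) x)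
           = (\<Sum>k = 1..l + 1. y k * f_poly F (k - 1) y)"
      using 3 by (intro sum.cong refl arg_cong2[where f = "(*)"] IH less.prems) auto
    have "x (l + 2) = y (l + 2)" "f_poly F l x = f_poly F l y"
         "f_poly F (l + 1) x = f_poly F (l + 1) y"
      using 3 by (intro IH less.prems; simp)+
    with s 3 show ?thesis by (simp only: f_poly.simps)
  qed (use less.prems in simp_all)
qed

end

theory Submission
  imports Defs
begin

text \<open>
  Call an integer \<open>d \<ge> 0\<close> reached at \<open>n\<close> if some sequence has
  \<open>n = \<Sum>k\<le>m. x\<^sub>k f\<^bsub>k-1\<^esub>\<close> and \<open>d = \<bar>f\<^sub>m\<bar>\<close>.
  The recursion for \<open>f\<^sub>m\<close> is Taylor's formula in disguise: it is what makes
  \<open>F(\<Sum>k\<le>m. x\<^sub>k f\<^bsub>k-1\<^esub>) = f\<^bsub>m-1\<^esub> f\<^sub>m\<close> survive the passage from \<open>m\<close> to \<open>m + 1\<close>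
  (\<open>poly_f_sum\<close>). Appending one more entry to a sequence therefore moves the point
  \<open>r\<close> by an arbitrary multiple of \<open>d\<close> and replaces the divisor \<open>d\<close> of \<open>F(r)\<close> by its
  cofactor in the value of \<open>F\<close> at the new point (\<open>reached_cofactor\<close>). Staying at the same
  point, that is appending \<open>0\<close>, exchanges the two factors.

  The theorem follows by descent on \<open>\<bar>F(n)\<bar>\<close>. The divisor \<open>\<bar>F(n)\<bar>\<close> is reached by the
  one-term sequence \<open>n\<close>, and hence so is its cofactor \<open>1\<close>. For a non-trivial factorization
  \<open>F(n) = p q\<close>, the criterion supplies a point \<open>r\<close> with a smaller value of \<open>F\<close>, congruent to
  \<open>n\<close> modulo one of the factors; this factor divides \<open>F(r)\<close>, so by induction it is reached
  at \<open>r\<close>, and one step from \<open>r\<close> to \<open>n\<close> reaches the other factor at \<open>n\<close>; a further step that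
  stays at \<open>n\<close> then reaches the first one too. The descent needs
  \<open>F(n) \<noteq> 0\<close>, which holds because no \<open>r\<close> can serve the non-trivial factorization
  \<open>0 = 0 \<cdot> 0\<close>.
\<close>

lemma higher_pderiv_pcompose_shift:
  fixes F :: "int poly"
  shows "(pderiv ^^ j) (F \<circ>\<^sub>p [:a, 1:]) = (pderiv ^^ j) F \<circ>\<^sub>p [:a, 1:]"
  by (induction j) (simp_all add: pderiv_pcompose pderiv_pCons)

text \<open>The divided derivatives of \<open>F\<close> at \<open>a\<close> are the coefficients of \<open>F(a + X)\<close>, since the
  constant term of the \<open>j\<close>th derivative of a polynomial is \<open>j!\<close> times its \<open>j\<close>th coefficient.\<close>

lemma coeff_pcompose_shift:
  fixes F :: "int poly"
  shows "coeff (F \<circ>\<^sub>p [:a, 1:]) j = poly (divided_deriv j F) a"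
proof -
  have "fact j * coeff (F \<circ>\<^sub>p [:a, 1:]) j = coeff ((pderiv ^^ j) (F \<circ>\<^sub>p [:a, 1:])) 0"
    by (simp add: coeff_higher_pderiv pochhammer_fact)
  also have "\<dots> = poly ((pderiv ^^ j) F) a"
    by (simp add: higher_pderiv_pcompose_shift poly_pcompose flip: poly_0_coeff_0)
  also have "\<dots> = fact j * poly (divided_deriv j F) a"
    by (simp flip: divided_deriv_exact)
  finally show ?thesis
    by simp
qed

lemma poly_taylor:
  "poly F (a + h) = poly F a + h * (\<Sum>j = 1..degree F. poly (divided_deriv j F) a * h ^ (j - 1))"
proof -
  have "poly F (a + h) = poly (F \<circ>\<^sub>p [:a, 1:]) h"
    by (simp add: poly_pcompose)
  also have "\<dots> = (\<Sum>j\<le>degree F. poly (divided_deriv j F) a * h ^ j)"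
    by (subst poly_altdef) (simp add: degree_pcompose coeff_pcompose_shift)
  also have "\<dots> = poly (divided_deriv 0 F) a
      + (\<Sum>j = 1..degree F. poly (divided_deriv j F) a * h ^ j)"
    by (simp add: sum.atMost_shift sum.atLeast1_atMost_eq)
  also have "(\<Sum>j = 1..degree F. poly (divided_deriv j F) a * h ^ j)
      = h * (\<Sum>j = 1..degree F. poly (divided_deriv j F) a * h ^ (j - 1))"
    unfolding sum_distrib_left
    by (intro sum.cong refl) (auto simp: power_eq_if)
  also have "poly (divided_deriv 0 F) a = poly F a"
    by (simp add: poly_pcompose flip: coeff_pcompose_shift poly_0_coeff_0)
  finally show ?thesis .
qed

definition f_sum :: "int poly \<Rightarrow> nat \<Rightarrow> (nat \<Rightarrow> int) \<Rightarrow> int" where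
  "f_sum F m x = (\<Sum>k = 1..m. x k * f_poly F (k - 1) x)"

lemma f_sum_Suc: "f_sum F (Suc m) x = f_sum F m x + x (Suc m) * f_poly F m x"
  by (simp add: f_sum_def)

lemma f_sum_cong:
  assumes "\<And>k. 1 \<le> k \<Longrightarrow> k \<le> m \<Longrightarrow> x k = y k"
  shows "f_sum F m x = f_sum F m y"
  unfolding f_sum_def
  using assms by (intro sum.cong refl arg_cong2[where f = "(*)"] f_poly_cong) auto

text \<open>Moving from the \<open>m\<close>-term sum to the next one adds \<open>h = x\<^bsub>m+1\<^esub> f\<^sub>m\<close>. By induction and
  Taylor's formula, both the old value \<open>f\<^bsub>m-1\<^esub> f\<^sub>m\<close> and the increment are multiples of \<open>f\<^sub>m\<close>,
  and the cofactor is \<open>f\<^bsub>m+1\<^esub>\<close> by definition.\<close>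

lemma poly_f_sum: "poly F (f_sum F (Suc m) x) = f_poly F m x * f_poly F (Suc m) x"
proof (induction m)
  case 0
  show ?case by (simp add: f_sum_def)
next
  case (Suc m)
  define h where "h = x (Suc (Suc m)) * f_poly F (Suc m) x"
  define S where "S = (\<Sum>j = 1..degree F. poly (divided_deriv j F) (f_sum F (Suc m) x) * h ^ (j - 1))"
  have "poly F (f_sum F (Suc (Suc m)) x) = poly F (f_sum F (Suc m) x) + h * S"
    unfolding f_sum_Suc[of F "Suc m"] h_def[symmetric] S_def by (rule poly_taylor)
  also have "\<dots> = f_poly F (Suc m) x * (f_poly F m x + x (Suc (Suc m)) * S)"
    by (simp add: Suc.IH h_def algebra_simps)
  also have "f_poly F m x + x (Suc (Suc m)) * S = f_poly F (Suc (Suc m)) x"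
    by (simp add: S_def h_def f_sum_def)
  finally show ?case .
qed

definition reached :: "int poly \<Rightarrow> int \<Rightarrow> int \<Rightarrow> bool" where
  "reached F n d \<longleftrightarrow> (\<exists>m x. m \<ge> 1 \<and> n = f_sum F m x \<and> d = \<bar>f_poly F m x\<bar>)"

lemma reached_abs_poly: "reached F n \<bar>poly F n\<bar>"
  unfolding reached_def by (rule exI[of _ 1], rule exI[of _ "\<lambda>_. n"]) (simp add: f_sum_def)

text \<open>The step of the descent. The new entry is the multiple of \<open>f\<^sub>m = \<plusminus>d\<close> that separates \<open>n\<close>
  from \<open>r\<close>; then \<open>F(n) = f\<^sub>m f\<^bsub>m+1\<^esub>\<close> forces \<open>\<bar>f\<^bsub>m+1\<^esub>\<bar>\<close> to be the cofactor of \<open>d\<close>.\<close>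

lemma reached_cofactor:
  assumes "reached F r d" "[r = n] (mod d)" "poly F n = d * e" "d \<noteq> 0"
  shows "reached F n \<bar>e\<bar>"
proof -
  obtain m x where m: "m \<ge> 1" and r: "r = f_sum F m x" and d: "d = \<bar>f_poly F m x\<bar>"
    using assms(1) unfolding reached_def by blast
  have "f_poly F m x dvd n - r"
    using assms(2) d by (metis abs_dvd_iff cong_iff_dvd_diff cong_sym)
  then obtain y where y: "n - r = f_poly F m x * y" ..
  define z where "z = x(Suc m := y)"
  have f: "f_poly F m z = f_poly F m x" and s: "f_sum F m z = f_sum F m x"
    by (auto simp: z_def intro!: f_poly_cong f_sum_cong)
  have n: "n = f_sum F (Suc m) z"
    using y by (simp add: f_sum_Suc f s r) (simp add: z_def algebra_simps)
  have "d * e = f_poly F m x * f_poly F (Suc m) z"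
    using poly_f_sum[of F m z] by (simp add: f assms(3) flip: n)
  then have "d * \<bar>f_poly F (Suc m) z\<bar> = d * \<bar>e\<bar>"
    by (metis abs_mult d abs_abs)
  then have "\<bar>e\<bar> = \<bar>f_poly F (Suc m) z\<bar>"
    using assms(4) by simp
  then show ?thesis
    unfolding reached_def using n by (intro exI[of _ "Suc m"] exI[of _ z]) simp
qed

lemma recursively_factorable_no_root:
  assumes "recursively_factorable F"
  shows "poly F n \<noteq> 0"
proof
  assume "poly F n = 0"
  then have "poly F n = 0 * 0 \<and> \<not> trivial_factorization 0 0"
    by (simp add: trivial_factorization_def)
  then obtain r where "\<bar>poly F r\<bar> < \<bar>poly F n\<bar>"
    using assms unfolding recursively_factorable_def rec_factorable_at_def by blast
  with \<open>poly F n = 0\<close> show False by simp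
qed

lemma recursively_factorable_reached:
  assumes "recursively_factorable F" "p > 0" "p dvd poly F n"
  shows "reached F n p"
  using assms(2,3)
proof (induction "nat \<bar>poly F n\<bar>" arbitrary: n p rule: less_induct)
  case less
  obtain q where q: "poly F n = p * q"
    using less.prems by blast
  have nz: "poly F n \<noteq> 0"
    using assms(1) by (rule recursively_factorable_no_root)
  then have q0: "q \<noteq> 0"
    using q by auto
  \<comment> \<open>Steps that stay at \<open>n\<close> exchange the two factors.\<close>
  have swap: "reached F n p" if "reached F n \<bar>q\<bar>"
  proof -
    have "poly F n = \<bar>q\<bar> * (sgn q * p)"
      by (simp add: q abs_sgn algebra_simps)
    from reached_cofactor[OF that cong_refl this] q0 less.prems(1)
    show ?thesis by (simp add: abs_mult)
  qed
  consider "p = 1" | "\<bar>q\<bar> = 1" | "\<not> trivial_factorization p q"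
    using less.prems(1) by (auto simp: trivial_factorization_def)
  then show ?case
  proof cases
    case 1
    then show ?thesis
      using swap reached_abs_poly[of F n] q by simp
  next
    case 2
    then show ?thesis
      using reached_abs_poly[of F n] q less.prems(1) by (simp add: abs_mult)
  next
    case 3
    obtain r where r: "\<bar>poly F r\<bar> < \<bar>poly F n\<bar>"
      and cong: "[r = n] (mod p) \<or> [r = n] (mod \<bar>q\<bar>)"
      using assms(1) q 3 less.prems(1)
      unfolding recursively_factorable_def rec_factorable_at_def by (metis abs_of_pos)
    have IH: "reached F r d" if "[r = n] (mod d)" "d dvd poly F n" "d > 0" for d
    proof (rule less.hyps)
      have "d dvd r - n"
        using that(1) by (simp add: cong_iff_dvd_diff)
      then show "d dvd poly F r"
        using that(2) poly_taylor[of F n "r - n"] by simp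
    qed (use r that in auto)
    from cong show ?thesis
    proof
      assume c: "[r = n] (mod p)"
      then have "reached F r p"
        using less.prems by (intro IH) auto
      then have "reached F n \<bar>q\<bar>"
        using c q less.prems(1) by (intro reached_cofactor) auto
      then show ?thesis by (rule swap)
    next
      assume c: "[r = n] (mod \<bar>q\<bar>)"
      then have "reached F r \<bar>q\<bar>"
        using q q0 by (intro IH) auto
      moreover have "poly F n = \<bar>q\<bar> * (sgn q * p)"
        by (simp add: q abs_sgn algebra_simps)
      ultimately have "reached F n \<bar>sgn q * p\<bar>"
        using reached_cofactor[OF _ c] q0 by simp
      then show ?thesis
        using q0 less.prems(1) by (simp add: abs_mult)
    qed
  qed
qed

theorem theorem3p4:
  fixes F :: "int poly"
  assumes "recursively_factorable F"
  shows "\<forall>n p :: int. p > 0 \<and> p dvd poly F n \<longrightarrow>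
           (\<exists>(m::nat) (x :: nat \<Rightarrow> int). m \<ge> 1 \<and>
              n = (\<Sum>k = 1..m. x k * f_poly F (k - 1) x) \<and>
              p = \<bar>f_poly F m x\<bar>)"
  using recursively_factorable_reached[OF assms]
  unfolding reached_def f_sum_def by blast

end
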